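(* Let $n\ge 2$ be an integer, $k=n-1$, and consider the game $SN(n,k)$. For a position $\mathbf p$ let $s=\Sigma(\mathbf p)\bmod 2k$ (taken in $\{0,1,\dots,2k-1\}$) and let $o$ be the number of indices $i$ with $p_i$ odd. Then for every position $s$ and $o$ have the same parity. Moreover, a reduced position $\mathbf p$ is a P-position of $SN(n,k)$ if and only if its pair $(s,o)$ belongs to $S_1\cup S_2\cup S_3$, where $S_1=\{(s,o): s\equiv o \pmod 2,\ 0\le s<k-1,\ o\le s\}$, $S_2=\{(n-2,o): o\equiv n \pmod 2\}$, $S_3=\{(s,o): s\equiv o\pmod 2,\ k-1<s<2k-1,\ o\le 2(k-1)-s\}$.
   Context: For an integer $n\ge 1$ and a nonempty set $A\subseteq\{1,\dots,n\}$, the game $SN(n,A)$ (Slow SetNim) is played on $n$ stacks of tokens; a position is $\mathbf p=(p_1,\dots,p_n)$ of nonnegative integers ($p_i$ is the height of stack $i$), written in non-decreasing order so that $p_n=\max_i p_i$; stacks of height $0$ still count as stacks. A move consists of choosing some $\ell\in A$ and $\ell$ distinct stacks, each of height at least $1$, and removing exactly one token from each chosen stack. Players alternate; a player unable to move loses (normal play). A P-position is one from which the player to move loses under optimal play; an N-position is one from which the player to move wins. $SN(n,k)$ denotes $SN(n,\{k\})$, and $\Sigma(\mathbf p)=\sum_i p_i$. A terminal position is one with no legal move. For a position $\mathbf p$, let $\mathcal T(\mathbf p)$ be the set of terminal positions reachable from $\mathbf p$ by finite sequences of legal moves, let $u_i(\mathbf p)=\min\{t_i:\mathbf t\in\mathcal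 T(\mathbf p)\}$, and define the reduction $r(\mathbf p)=\mathbf p-u(\mathbf p)$. The position $\mathbf p$ is reduced if $r(\mathbf p)=\mathbf p$ (equivalently, for every $i$ some terminal position reachable from $\mathbf p$ has its $i$-th stack equal to $0$). *)

theory Defs
  imports Main
begin

text \<open>A position of \<open>SN(n,A)\<close> is a list of length \<open>n\<close>; the entry with (0-based) index \<open>i\<close> is the
  height of a stack. Stacks keep their identity during play: lists are neither required to be
  non-decreasing nor re-sorted after a move, since ordering the stacks only fixes a representative
  up to permutation. In particular a coordinate of a reachable terminal position refers to the
  same physical stack as in the starting position.\<close>

definition positions :: "nat \<Rightarrow> nat list set" where
  "positions n = {p. length p = n}"

definition move :: "nat set \<Rightarrow> nat list \<Rightarrow> nat list \<Rightarrow> bool" where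
  "move A p q \<longleftrightarrow> (\<exists>L \<subseteq> {..<length p}. card L \<in> A \<and> (\<forall>i\<in>L. p ! i \<ge> 1) \<and>
     q = map (\<lambda>i. if i \<in> L then p ! i - 1 else p ! i) [0..<length p])"

inductive P_position :: "nat set \<Rightarrow> nat list \<Rightarrow> bool"
  and N_position :: "nat set \<Rightarrow> nat list \<Rightarrow> bool"
  for A :: "nat set" where
  P: "(\<And>q. move A p q \<Longrightarrow> N_position A q) \<Longrightarrow> P_position A p"
| N: "move A p q \<Longrightarrow> P_position A q \<Longrightarrow> N_position A p"

definition terminal :: "nat set \<Rightarrow> nat list \<Rightarrow> bool" where
  "terminal A p \<longleftrightarrow> \<not> (\<exists>q. move A p q)"

definition reachable_terminals :: "nat set \<Rightarrow> nat list \<Rightarrow> nat list set" where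
  "reachable_terminals A p = {t. (move A)\<^sup>*\<^sup>* p t \<and> terminal A t}"

text \<open>For \<open>0 \<notin> A\<close> the set of reachable terminal positions is finite and nonempty (proved below), so
  \<open>Min\<close> is a genuine minimum, and it is at most \<open>p ! i\<close>, so the subtraction in the reduction
  does not truncate.\<close>

definition unused :: "nat set \<Rightarrow> nat list \<Rightarrow> nat \<Rightarrow> nat" where
  "unused A p i = Min {t ! i | t. t \<in> reachable_terminals A p}"

definition reduction :: "nat set \<Rightarrow> nat list \<Rightarrow> nat list" where
  "reduction A p = map (\<lambda>i. p ! i - unused A p i) [0..<length p]"

definition reduced :: "nat set \<Rightarrow> nat list \<Rightarrow> bool" where
  "reduced A p \<longleftrightarrow> reduction A p = p"

definition num_odd :: "nat list \<Rightarrow> nat" where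
  "num_odd p = card {i. i < length p \<and> odd (p ! i)}"

text \<open>The sets of pairs \<open>(s, o)\<close>. They are used for \<open>n \<ge> 2\<close> and \<open>k = n - 1 \<ge> 1\<close> only; then none of
  the subtractions on natural numbers below truncates (in \<open>S3\<close>, \<open>s < 2 * k - 1\<close> gives
  \<open>s \<le> 2 * (k - 1)\<close>).\<close>

definition S1 :: "nat \<Rightarrow> (nat \<times> nat) set" where
  "S1 k = {(s, d). s mod 2 = d mod 2 \<and> 0 \<le> s \<and> s < k - 1 \<and> d \<le> s}"

definition S2 :: "nat \<Rightarrow> (nat \<times> nat) set" where
  "S2 n = {(s, d). s = n - 2 \<and> d mod 2 = n mod 2}"

definition S3 :: "nat \<Rightarrow> (nat \<times> nat) set" where
  "S3 k = {(s, d). s mod 2 = d mod 2 \<and> k - 1 < s \<and> s < 2 * k - 1 \<and> d \<le> 2 * (k - 1) - s}"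


lemma move_length: "move A p q \<Longrightarrow> length q = length p"
  by (auto simp: move_def)

lemma move_le: "move A p q \<Longrightarrow> i < length p \<Longrightarrow> q ! i \<le> p ! i"
  by (auto simp: move_def)

lemma move_sum_less:
  assumes "0 \<notin> A" "move A p q"
  shows "sum_list q < sum_list p"
proof -
  from assms(2) obtain L where L: "L \<subseteq> {..<length p}" "card L \<in> A" "\<forall>i\<in>L. p ! i \<ge> 1"
    and q: "q = map (\<lambda>i. if i \<in> L then p ! i - 1 else p ! i) [0..<length p]"
    unfolding move_def by blast
  have "L \<noteq> {}" using L(2) assms(1) by (metis card.empty)
  then obtain j where j: "j \<in> L" by blast
  have "(\<Sum>i = 0..<length p. q ! i) < (\<Sum>i = 0..<length p. p ! i)"
  proof (rule sum_strict_mono_ex1)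
    show "\<forall>i\<in>{0..<length p}. q ! i \<le> p ! i" using move_le[OF assms(2)] by auto
    show "\<exists>i\<in>{0..<length p}. q ! i < p ! i"
      using j L(1,3) q by (intro bexI[of _ j]) (auto simp: Suc_le_eq)
  qed simp
  then show ?thesis using move_length[OF assms(2)] by (simp add: sum_list_sum_nth)
qed

lemma N_position_iff_not_P_position:
  assumes "0 \<notin> A"
  shows "N_position A p \<longleftrightarrow> \<not> P_position A p"
proof (induction p rule: measure_induct_rule[of sum_list])
  case (less p)
  then show ?case
    by (metis N_position.simps P_position.simps move_sum_less[OF assms])
qed

lemma reachable_length_le:
  "(move A)\<^sup>*\<^sup>* p t \<Longrightarrow> length t = length p \<and> (\<forall>i < length p. t ! i \<le> p ! i)"
proof (induction rule: rtranclp_induct)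
  case (step y z)
  then show ?case
    using move_length[of A y z] move_le[of A y z] by (metis order_trans)
qed simp

lemma finite_reachable_terminals: "finite (reachable_terminals A p)"
proof (rule finite_subset)
  show "reachable_terminals A p \<subseteq> {t. set t \<subseteq> {..Max (set p)} \<and> length t = length p}"
  proof
    fix t assume "t \<in> reachable_terminals A p"
    then have t: "length t = length p" "\<forall>i < length p. t ! i \<le> p ! i"
      using reachable_length_le by (auto simp: reachable_terminals_def)
    have "t ! i \<le> Max (set p)" if "i < length p" for i
      using t(2) that by (meson List.finite_set Max_ge nth_mem order_trans)
    then show "t \<in> {t. set t \<subseteq> {..Max (set p)} \<and> length t = length p}"
      using t(1) by (auto simp: in_set_conv_nth)
  qed
qed (rule finite_lists_length_eq, simp)

lemma reachable_terminals_nonempty: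
  assumes "0 \<notin> A"
  shows "reachable_terminals A p \<noteq> {}"
proof (induction p rule: measure_induct_rule[of sum_list])
  case (less p)
  show ?case
  proof (cases "terminal A p")
    case True
    then show ?thesis by (auto simp: reachable_terminals_def)
  next
    case False
    then obtain q where q: "move A p q" by (auto simp: terminal_def)
    with less move_sum_less[OF assms q] obtain t where "t \<in> reachable_terminals A q" by blast
    with q have "t \<in> reachable_terminals A p"
      by (auto simp: reachable_terminals_def intro: converse_rtranclp_into_rtranclp)
    then show ?thesis by blast
  qed
qed

end

theory Submission
  imports Defs
begin

text \<open>A move of \<open>SN(n, n - 1)\<close> skips one stack \<open>j\<close> and lowers all others. If at most \<open>m\<close> moves
  can still be made, stack \<open>i\<close> has to be skipped \<open>m - p\<^sub>i\<close> times (truncated subtraction) to last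
  that long, and \<open>r = m - (\<Sum>i. m - p\<^sub>i)\<close> skips are free. Only the deficits \<open>m - p\<^sub>i\<close> and \<open>r\<close>
  matter: skipping a stack with positive deficit lowers that deficit and \<open>m\<close>; skipping one with
  deficit \<open>0\<close> lowers \<open>r\<close> and \<open>m\<close> if \<open>r > 0\<close>, and if \<open>r = 0\<close> it costs two moves, lowers all positive
  deficits, and sets \<open>r\<close> to the number of these minus \<open>2\<close>. In these terms, with \<open>h\<close> odd deficits,
  the P-positions are those with \<open>m\<close> even and \<open>h \<le> r\<close> or \<open>r = n - 2\<close>, and those with \<open>m\<close> odd and
  \<open>h \<ge> r + 3\<close>. For a reduced position \<open>m\<close> and \<open>r\<close> are quotient and remainder of \<open>\<Sigma>(p)\<close> by \<open>n - 1\<close>.\<close>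

section \<open>Moves as skips of a single stack\<close>

definition skip :: "nat list \<Rightarrow> nat \<Rightarrow> nat list" where
  "skip p j = map (\<lambda>i. if i = j then p ! i else p ! i - 1) [0..<length p]"

text \<open>Stack \<open>j\<close> itself may be empty. The other stacks must not be, so the
  truncated subtraction in \<open>skip\<close> is exact for legal moves.\<close>

definition skippable :: "nat list \<Rightarrow> nat \<Rightarrow> bool" where
  "skippable p j \<longleftrightarrow> j < length p \<and> (\<forall>i<length p. i \<noteq> j \<longrightarrow> 0 < p ! i)"

lemma length_skip [simp]: "length (skip p j) = length p"
  by (simp add: skip_def)

lemma nth_skip: "i < length p \<Longrightarrow> skip p j ! i = (if i = j then p ! i else p ! i - 1)"
  by (simp add: skip_def)

lemma move_iff_skip:
  assumes "length p \<ge> 1"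
  shows "move {length p - 1} p q \<longleftrightarrow> (\<exists>j. skippable p j \<and> q = skip p j)"
proof
  assume "move {length p - 1} p q"
  then obtain L where L: "L \<subseteq> {..<length p}" "card L = length p - 1" "\<forall>i\<in>L. p ! i \<ge> 1"
    and q: "q = map (\<lambda>i. if i \<in> L then p ! i - 1 else p ! i) [0..<length p]"
    unfolding move_def by blast
  have "card ({..<length p} - L) = 1"
    using L assms by (simp add: card_Diff_subset finite_subset[OF L(1)])
  then obtain j where j: "{..<length p} - L = {j}" by (auto simp: card_1_singleton_iff)
  have mem: "i \<in> L \<longleftrightarrow> i \<noteq> j" if "i < length p" for i
    using j that by blast
  have "skippable p j"
    using L(3) j mem by (fastforce simp: skippable_def)
  moreover have "q = skip p j"
    using mem by (auto simp: q skip_def)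
  ultimately show "\<exists>j. skippable p j \<and> q = skip p j" by blast
next
  assume "\<exists>j. skippable p j \<and> q = skip p j"
  then obtain j where j: "skippable p j" and q: "q = skip p j" by blast
  show "move {length p - 1} p q"
    unfolding move_def
    using j q by (intro exI[of _ "{..<length p} - {j}"]) (auto simp: skippable_def skip_def)
qed

lemma P_position_iff_skip:
  assumes "length p \<ge> 2"
  shows "P_position {length p - 1} p \<longleftrightarrow>
    (\<forall>j. skippable p j \<longrightarrow> \<not> P_position {length p - 1} (skip p j))"
proof -
  have "0 \<notin> {length p - 1}" using assms by auto
  then have "P_position {length p - 1} p \<longleftrightarrow>
      (\<forall>q. move {length p - 1} p q \<longrightarrow> \<not> P_position {length p - 1} q)"
    by (metis N_position_iff_not_P_position P_position.simps)
  then show ?thesis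
    using move_iff_skip[of p] assms by auto
qed

section \<open>Deficits and free skips: parity and size constraints\<close>

text \<open>The last conjunct says that \<open>m\<close> is maximal: \<open>m + 1\<close> moves would need more than \<open>m + 1\<close> skips.\<close>

definition budget :: "nat list \<Rightarrow> nat \<Rightarrow> nat \<Rightarrow> bool" where
  "budget p m r \<longleftrightarrow> (\<Sum>i<length p. m - p ! i) + r = m \<and> r + 2 \<le> card {i. i < length p \<and> p ! i \<le> m}"

definition odd_deficits :: "nat list \<Rightarrow> nat \<Rightarrow> nat" where
  "odd_deficits p m = card {i. i < length p \<and> odd (m - p ! i)}"

lemma even_sum_iff_even_card_odd:
  fixes f :: "'a \<Rightarrow> nat"
  assumes "finite A"
  shows "even (sum f A) \<longleftrightarrow> even (card {i \<in> A. odd (f i)})"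
  using even_sum_iff[OF assms, of f] by simp

text \<open>The deficits sum to \<open>m - r\<close>, and a sum has the parity of its number of odd
  terms. This excludes the borderline values of \<open>odd_deficits\<close> between the two
  outcomes.\<close>

lemma budget_parity:
  assumes "budget p m r"
  shows "even (odd_deficits p m + r) \<longleftrightarrow> even m"
proof -
  have "even (\<Sum>i<length p. m - p ! i) \<longleftrightarrow> even (odd_deficits p m)"
    using even_sum_iff_even_card_odd[of "{..<length p}" "\<lambda>i. m - p ! i"]
    by (simp add: odd_deficits_def)
  moreover have "(\<Sum>i<length p. m - p ! i) + r = m" using assms by (simp add: budget_def)
  ultimately show ?thesis by (metis even_add)
qed

lemma odd_deficits_le: "odd_deficits p m \<le> length p"
  unfolding odd_deficits_def by (rule order_trans[OF card_mono[of "{..<length p}"]]) auto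

lemma budget_bound: "budget p m r \<Longrightarrow> r + 2 \<le> length p"
  unfolding budget_def
  using card_mono[of "{..<length p}" "{i. i < length p \<and> p ! i \<le> m}"] by force

text \<open>Serves to show that skips are legal: an empty stack has deficit \<open>m\<close>, which
  leaves room neither for a second positive deficit nor for a positive \<open>r\<close>.\<close>

lemma deficits_le:
  assumes "budget p m r" "i < length p" "j < length p" "i \<noteq> j"
  shows "(m - p ! i) + (m - p ! j) + r \<le> m"
proof -
  have "(\<Sum>l\<in>{i,j}. m - p ! l) \<le> (\<Sum>l<length p. m - p ! l)"
    by (rule sum_mono2) (use assms in auto)
  then show ?thesis using assms by (simp add: budget_def)
qed

section \<open>Effect of a skip on deficits and free skips\<close>

text \<open>The bound and all heights except that of \<open>j\<close> fall by one, so only the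
  deficit of \<open>j\<close> changes: it drops by one and flips parity. The total falls together
  with the bound, hence \<open>r\<close> stays.\<close>

lemma skip_positive_deficit:
  assumes b: "budget p (Suc m) r" and j: "j < length p" "p ! j \<le> m"
  shows "skippable p j" and "budget (skip p j) m r"
    and "odd (Suc m - p ! j) \<Longrightarrow> odd_deficits p (Suc m) = Suc (odd_deficits (skip p j) m)"
    and "even (Suc m - p ! j) \<Longrightarrow> odd_deficits (skip p j) m = Suc (odd_deficits p (Suc m))"
proof -
  have pos: "0 < p ! i" if "i < length p" "i \<noteq> j" for i
    using deficits_le[OF b that(1) j(1) that(2)] j by (cases "p ! i") auto
  then show "skippable p j" using j by (simp add: skippable_def)
  have d: "m - skip p j ! i = Suc m - p ! i" if "i < length p" "i \<noteq> j" for i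
    using pos[OF that] that by (simp add: nth_skip)
  have dj: "Suc m - p ! j = Suc (m - skip p j ! j)"
    using j by (simp add: nth_skip)
  have "(\<Sum>i<length p. Suc m - p ! i) = (Suc m - p ! j) + (\<Sum>i\<in>{..<length p} - {j}. Suc m - p ! i)"
    using j by (intro sum.remove) auto
  moreover have "(\<Sum>i<length p. m - skip p j ! i)
      = (m - skip p j ! j) + (\<Sum>i\<in>{..<length p} - {j}. m - skip p j ! i)"
    using j by (intro sum.remove) auto
  moreover have "(\<Sum>i\<in>{..<length p} - {j}. m - skip p j ! i) = (\<Sum>i\<in>{..<length p} - {j}. Suc m - p ! i)"
    by (rule sum.cong) (auto simp: d)
  ultimately have s: "(\<Sum>i<length p. Suc m - p ! i) = Suc (\<Sum>i<length p. m - skip p j ! i)"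
    using dj by simp
  have "{i. i < length p \<and> skip p j ! i \<le> m} = {i. i < length p \<and> p ! i \<le> Suc m}"
    using j by (auto simp: nth_skip split: if_splits)
  then show "budget (skip p j) m r"
    using b s by (simp add: budget_def)
  let ?O = "{i. i < length p \<and> odd (Suc m - p ! i)}"
  let ?O' = "{i. i < length p \<and> odd (m - skip p j ! i)}"
  show "odd_deficits p (Suc m) = Suc (odd_deficits (skip p j) m)" if "odd (Suc m - p ! j)"
  proof -
    have "x \<in> ?O \<longleftrightarrow> x \<in> insert j ?O'" for x
      using that j d[of x] by (cases "x = j") (auto simp del: even_diff_nat)
    then have "?O = insert j ?O'" by blast
    moreover have "j \<notin> ?O'" using that dj by (simp del: even_diff_nat)
    ultimately show ?thesis by (simp add: odd_deficits_def del: even_diff_nat)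
  qed
  show "odd_deficits (skip p j) m = Suc (odd_deficits p (Suc m))" if "even (Suc m - p ! j)"
  proof -
    have "x \<in> ?O' \<longleftrightarrow> x \<in> insert j ?O" for x
      using that j d[of x] dj by (cases "x = j") (auto simp del: even_diff_nat)
    then have "?O' = insert j ?O" by blast
    moreover have "j \<notin> ?O" using that by (simp del: even_diff_nat)
    ultimately show ?thesis by (simp add: odd_deficits_def del: even_diff_nat)
  qed
qed

text \<open>Every deficit is unchanged, that of \<open>j\<close> being 0 before and after, so the
  loss of one move is paid from the free skips. Only \<open>j\<close> can leave the set counted in
  \<open>budget\<close>, which the smaller \<open>r\<close> compensates.\<close>

lemma skip_zero_deficit:
  assumes b: "budget p (Suc m) (Suc r)" and j: "j < length p" "Suc m \<le> p ! j"
  shows "skippable p j" and "budget (skip p j) m r"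
    and "odd_deficits (skip p j) m = odd_deficits p (Suc m)"
proof -
  have pos: "0 < p ! i" if "i < length p" "i \<noteq> j" for i
    using deficits_le[OF b that(1) j(1) that(2)] j by (cases "p ! i") auto
  then show "skippable p j" using j by (simp add: skippable_def)
  have d: "m - skip p j ! i = Suc m - p ! i" if "i < length p" for i
    using pos[of i] that j by (cases "i = j") (auto simp: nth_skip)
  have "card {i. i < length p \<and> p ! i \<le> Suc m} \<le> card (insert j {i. i < length p \<and> skip p j ! i \<le> m})"
    by (rule card_mono) (auto simp: nth_skip)
  also have "\<dots> \<le> Suc (card {i. i < length p \<and> skip p j ! i \<le> m})"
    by (simp add: card_insert_if)
  finally show "budget (skip p j) m r"
    using b d by (simp add: budget_def)
  have "{i. i < length p \<and> odd (m - skip p j ! i)} = {i. i < length p \<and> odd (Suc m - p ! i)}"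
    using d by (auto simp del: even_diff_nat)
  then show "odd_deficits (skip p j) m = odd_deficits p (Suc m)"
    by (simp add: odd_deficits_def)
qed

text \<open>With \<open>r = 0\<close> the deficits sum to \<open>m\<close>. An empty stack has
  deficit \<open>m\<close> and uses up the whole sum, so a second positive deficit excludes it.
  Conversely, a single positive deficit belongs to an empty stack, and no positive deficit means
  \<open>m = 0\<close> with two empty stacks.\<close>

lemma skippable_iff_zero_budget:
  assumes b: "budget p m 0" and j: "j < length p" "m \<le> p ! j"
  shows "skippable p j \<longleftrightarrow> 2 \<le> card {i. i < length p \<and> p ! i < m}"
proof
  assume sk: "skippable p j"
  let ?S = "{i. i < length p \<and> p ! i < m}"
  show "2 \<le> card ?S"
  proof (rule ccontr)
    assume "\<not> 2 \<le> card ?S"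
    then consider "card ?S = 0" | "card ?S = 1" by linarith
    then show False
    proof cases
      case 1
      then have "\<forall>i<length p. m \<le> p ! i" by (auto simp: not_less[symmetric])
      then have "(\<Sum>i<length p. m - p ! i) = 0" by simp
      then have "m = 0" using b by (simp add: budget_def)
      then have "2 \<le> card {i. i < length p \<and> p ! i = 0}" using b by (simp add: budget_def)
      moreover have "card {i. i < length p \<and> p ! i = 0} \<le> card {j}"
        using sk by (intro card_mono) (auto simp: skippable_def)
      ultimately show False by simp
    next
      case 2
      then obtain i where i: "?S = {i}" by (auto simp: card_1_singleton_iff)
      have mem: "l < length p \<and> p ! l < m \<longleftrightarrow> l = i" for l
        using i by (simp add: set_eq_iff)
      have "(\<Sum>l<length p. m - p ! l) = (\<Sum>l\<in>{i}. m - p ! l)"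
      proof (rule sum.mono_neutral_right)
        show "\<forall>l\<in>{..<length p} - {i}. m - p ! l = 0"
          by (metis DiffE diff_is_0_eq insertI1 leI lessThan_iff mem)
      qed (use mem[of i] in auto)
      then have "m - p ! i = m" using b by (simp add: budget_def)
      moreover have "i < length p" "p ! i < m" "i \<noteq> j" using mem[of i] j by auto
      ultimately show False using sk by (auto simp: skippable_def)
    qed
  qed
next
  assume c: "2 \<le> card {i. i < length p \<and> p ! i < m}"
  have "0 < p ! i" if i: "i < length p" "i \<noteq> j" for i
  proof (rule ccontr)
    assume "\<not> 0 < p ! i"
    then have "p ! l \<ge> m" if "l < length p" "l \<noteq> i" for l
      using deficits_le[OF b i(1) that(1)] that by auto
    then have "card {i. i < length p \<and> p ! i < m} \<le> card {i}"
      by (intro card_mono) (use leD in blast)+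
    with c show False by simp
  qed
  then show "skippable p j" using j by (simp add: skippable_def)
qed

text \<open>Relative to \<open>m - 2\<close>, each of the \<open>c\<close> positive deficits is one
  smaller, so their sum is \<open>m - c\<close> and \<open>c - 2\<close> skips become free. Odd
  deficits turn even, and positive even ones turn odd.\<close>

lemma skip_zero_budget:
  assumes b: "budget p m 0" and j: "m \<le> p ! j" and sk: "skippable p j"
  defines "c \<equiv> card {i. i < length p \<and> p ! i < m}"
  shows "2 \<le> m" and "2 \<le> c" and "c < length p" and "budget (skip p j) (m - 2) (c - 2)"
    and "odd_deficits (skip p j) (m - 2) + odd_deficits p m = c"
proof -
  have jl: "j < length p" using sk by (simp add: skippable_def)
  let ?S = "{i. i < length p \<and> p ! i < m}"
  show c2: "2 \<le> c" using skippable_iff_zero_budget[OF b jl j] sk by (simp add: c_def)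
  have "card ?S \<le> card ({..<length p} - {j})"
    using j by (intro card_mono) auto
  then show "c < length p" using jl by (simp add: c_def)
  have sum_S: "(\<Sum>i<length p. m - p ! i) = (\<Sum>i\<in>?S. m - p ! i)"
    by (rule sum.mono_neutral_right) auto
  have "(\<Sum>i\<in>?S. 1) \<le> (\<Sum>i\<in>?S. m - p ! i)"
    by (rule sum_mono) auto
  then have cm: "c \<le> m" using b sum_S by (simp add: c_def budget_def)
  then show m2: "2 \<le> m" using c2 by simp
  have pos: "0 < p ! i" if "i < length p" "i \<noteq> j" for i
    using sk that by (simp add: skippable_def)
  have d: "m - 2 - skip p j ! i = m - p ! i - 1" if "i < length p" for i
    using pos[of i] that j m2 by (cases "i = j") (auto simp: nth_skip)
  have "(\<Sum>i<length p. m - 2 - skip p j ! i) = (\<Sum>i\<in>?S. m - p ! i - 1)"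
    by (rule sum.mono_neutral_cong_right) (auto simp: d simp del: diff_diff_left)
  also have "\<dots> = (\<Sum>i\<in>?S. m - p ! i) - (\<Sum>i\<in>?S. 1)"
    by (rule sum_subtractf_nat) auto
  also have "\<dots> = m - c"
    using b sum_S by (simp add: c_def budget_def)
  finally have s: "(\<Sum>i<length p. m - 2 - skip p j ! i) = m - c" .
  have "skip p j ! i \<le> m - 2 \<longleftrightarrow> p ! i < m" if "i < length p" for i
    using pos[of i] that j m2 by (cases "i = j") (auto simp: nth_skip)
  then have "{i. i < length p \<and> skip p j ! i \<le> m - 2} = ?S" by auto
  then show "budget (skip p j) (m - 2) (c - 2)"
    using s c2 cm by (simp add: budget_def c_def)
  have "{i. i < length p \<and> odd (m - 2 - skip p j ! i)} = ?S - {i. i < length p \<and> odd (m - p ! i)}"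
  proof (rule set_eqI)
    fix i
    \<comment> \<open>Truncation keeps deficit 0 at 0, so such stacks do not enter the odd
      set.\<close>
    have "odd (x - 1) \<longleftrightarrow> 0 < x \<and> even x" for x :: nat by (cases x) auto
    from this[of "m - p ! i"] show "i \<in> {i. i < length p \<and> odd (m - 2 - skip p j ! i)} \<longleftrightarrow>
        i \<in> ?S - {i. i < length p \<and> odd (m - p ! i)}"
      using d[of i] by (auto simp del: diff_diff_left even_diff_nat)
  qed
  moreover have "{i. i < length p \<and> odd (m - p ! i)} \<subseteq> ?S"
    by (auto dest: odd_pos simp del: even_diff_nat)
  ultimately show "odd_deficits (skip p j) (m - 2) + odd_deficits p m = c"
    by (simp add: odd_deficits_def c_def card_Diff_subset card_mono)
qed

section \<open>The P-positions in terms of deficits\<close>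

text \<open>Winning is meant for the player who has just moved. The value \<open>r + 2 = n\<close>
  is the largest that \<open>budget_bound\<close> permits.\<close>

definition winning_budget :: "nat \<Rightarrow> nat \<Rightarrow> nat \<Rightarrow> nat \<Rightarrow> bool" where
  "winning_budget n m r h \<longleftrightarrow> (if even m then r + 2 = n \<or> h \<le> r else r + 3 \<le> h)"

lemma winning_budget_skip:
  assumes b: "budget p m r" and w: "winning_budget (length p) m r (odd_deficits p m)"
    and sk: "skippable p j"
  shows "\<exists>m' r'. m' < m \<and> budget (skip p j) m' r' \<and>
    \<not> winning_budget (length p) m' r' (odd_deficits (skip p j) m')"
proof -
  have j: "j < length p" using sk by (simp add: skippable_def)
  note rb = budget_bound[OF b]
  note par = budget_parity[OF b]
  consider (pos) "p ! j < m" | (zero) r' where "m \<le> p ! j" "r = Suc r'" | (zero0) "m \<le> p ! j" "r = 0"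
    by (cases r) (auto simp: not_less[symmetric])
  then show ?thesis
  proof cases
    case pos
    then obtain m' where m': "m = Suc m'" by (cases m) auto
    have j': "p ! j \<le> m'" using pos m' by simp
    note S = skip_positive_deficit[OF b[unfolded m'] j j']
    have "\<not> winning_budget (length p) m' r (odd_deficits (skip p j) m')"
      using w S(3,4) m' rb odd_deficits_le[of p m] odd_deficits_le[of "skip p j" m'] budget_parity[OF S(2)] par
      by (cases "odd (Suc m' - p ! j)") (auto simp: winning_budget_def simp del: even_diff_nat split: if_splits)
    then show ?thesis using S(2) m' by blast
  next
    case zero
    then obtain m' where m': "m = Suc m'" using b by (cases m) (auto simp: budget_def)
    have j': "Suc m' \<le> p ! j" using zero m' by simp
    note S = skip_zero_deficit[OF b[unfolded m' zero(2)] j j']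
    \<comment> \<open>Stack \<open>j\<close> has deficit 0, so not all deficits are odd. This
      settles the extreme case \<open>r + 2 = length p\<close>, where the new value satisfies
      \<open>r' + 3 = length p\<close>.\<close>
    have "card {i. i < length p \<and> odd (m - p ! i)} \<le> card ({..<length p} - {j})"
      using zero by (intro card_mono) auto
    then have "odd_deficits p m < length p" using j by (simp add: odd_deficits_def)
    then have "\<not> winning_budget (length p) m' r' (odd_deficits (skip p j) m')"
      using w S(3) m' rb zero(2)
      by (auto simp: winning_budget_def split: if_splits)
    then show ?thesis using S(2) m' by blast
  next
    case zero0
    note S = skip_zero_budget[OF b[unfolded zero0(2)] zero0(1) sk]
    let ?c = "card {i. i < length p \<and> p ! i < m}"
    have "even (m - 2) = even m" using S(1) by simp
    then have "\<not> winning_budget (length p) (m - 2) (?c - 2) (odd_deficits (skip p j) (m - 2))"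
      using w S zero0(2) by (auto simp: winning_budget_def split: if_splits)
    then show ?thesis using S(1,4) by (intro exI[of _ "m - 2"] exI[of _ "?c - 2"]) auto
  qed
qed

text \<open>Gives an explicit reply. For odd \<open>m\<close> it aims at few odd deficits, for even
  \<open>m\<close> at many, except that with \<open>r = 0\<close> a two-move loss may make all
  deficits even at once.\<close>

lemma not_winning_budget_skip:
  assumes b: "budget p m r" and w: "\<not> winning_budget (length p) m r (odd_deficits p m)"
  shows "\<exists>j m' r'. skippable p j \<and> m' < m \<and> budget (skip p j) m' r' \<and>
    winning_budget (length p) m' r' (odd_deficits (skip p j) m')"
proof -
  let ?h = "odd_deficits p m"
  note rb = budget_bound[OF b]
  note par = budget_parity[OF b]
  have pos: ?thesis
    if j: "j < length p" "p ! j < m"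
      and w': "winning_budget (length p) (m - 1) r (if odd (m - p ! j) then ?h - 1 else ?h + 1)" for j
  proof -
    obtain m' where m': "m = Suc m'" using j by (cases m) auto
    have j': "p ! j \<le> m'" using j m' by simp
    note S = skip_positive_deficit[OF b[unfolded m'] j(1) j']
    have "winning_budget (length p) m' r (odd_deficits (skip p j) m')"
      using w' S(3,4) m' by (auto split: if_splits)
    then show ?thesis using S(1,2) m' by blast
  qed
  have free: ?thesis
    if j: "j < length p" "m \<le> p ! j" "0 < r" and w': "winning_budget (length p) (m - 1) (r - 1) ?h" for j
  proof -
    obtain m' r' where m': "m = Suc m'" "r = Suc r'"
      using j b by (cases m; cases r) (auto simp: budget_def)
    have j': "Suc m' \<le> p ! j" using j m' by simp
    note S = skip_zero_deficit[OF b[unfolded m'] j(1) j']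
    show ?thesis using S w' m' by (intro exI[of _ j] exI[of _ m'] exI[of _ r']) simp
  qed
  have odd_ex: "\<exists>j<length p. p ! j < m \<and> odd (m - p ! j)" if "?h > 0"
  proof -
    from that obtain j where "j < length p" "odd (m - p ! j)"
      by (auto simp: odd_deficits_def card_gt_0_iff)
    then show ?thesis by (metis odd_pos zero_less_diff)
  qed
  show ?thesis
  proof (cases "even m")
    case False
    have h: "?h \<le> r + 1"
    proof -
      \<comment> \<open>For odd \<open>m\<close>, \<open>budget_parity\<close> makes
        \<open>?h + r\<close> odd.\<close>
      have "?h \<noteq> r + 2" using par False by auto
      then show ?thesis using w False by (simp add: winning_budget_def)
    qed
    consider "?h > 0" | j where "?h = 0" "j < length p" "p ! j < m"
      | "?h = 0" "\<forall>j<length p. m \<le> p ! j" by (auto simp: not_less[symmetric])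
    then show ?thesis
    proof cases
      case 1
      then show ?thesis
        using odd_ex h False pos by (fastforce simp: winning_budget_def)
    next
      case 2
      then have "even (m - p ! j)" by (auto simp: odd_deficits_def)
      moreover have "odd r" using par False 2(1) by simp
      ultimately show ?thesis using 2 False odd_pos[of r] by (intro pos[of j]) (auto simp: winning_budget_def)
    next
      case 3
      have "odd r" using par False 3(1) by simp
      moreover have "0 < length p" using rb by linarith
      ultimately show ?thesis using 3 False odd_pos[of r]
        by (intro free[of 0]) (auto simp: winning_budget_def)
    qed
  next
    case True
    have r: "r + 2 < length p" and h: "r + 2 \<le> ?h"
    proof -
      have "?h \<noteq> r + 1" using par True by auto
      then show "r + 2 < length p" "r + 2 \<le> ?h"
        using w True rb by (auto simp: winning_budget_def)
    qed
    have m0: "m > 0" using odd_ex h by auto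
    \<comment> \<open>The replies in turn: spend a free skip, make an even positive deficit odd,
      give up one of the \<open>length p\<close> odd deficits, or skip a stack of deficit 0 when no
      skip is free.\<close>
    consider (zero) j where "j < length p" "m \<le> p ! j" "0 < r"
      | (even_pos) j where "j < length p" "p ! j < m" "even (m - p ! j)"
      | (all_odd) "\<forall>j<length p. p ! j < m \<and> odd (m - p ! j)"
      | (zero_odd) j where "j < length p" "m \<le> p ! j" "r = 0" "\<forall>j<length p. p ! j < m \<longrightarrow> odd (m - p ! j)"
      by (metis not_less gr0I)
    then show ?thesis
    proof cases
      case (zero j)
      then show ?thesis
        using True h m0 by (intro free[of j]) (auto simp: winning_budget_def)
    next
      case (even_pos j)
      then show ?thesis
        using True h m0 by (intro pos[of j]) (auto simp: winning_budget_def)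
    next
      case all_odd
      then have "{i. i < length p \<and> odd (m - p ! i)} = {..<length p}"
        by (auto simp del: even_diff_nat)
      then have hl: "?h = length p" by (simp add: odd_deficits_def)
      \<comment> \<open>After the skip \<open>length p - 1\<close> odd deficits remain, and
        \<open>r + 3\<close> are needed; parity supplies the missing unit.\<close>
      have "r + 3 \<noteq> length p"
      proof
        assume "r + 3 = length p"
        then have "?h + r = 2 * r + 3" using hl by simp
        then show False using par True by simp
      qed
      moreover have "0 < length p" using r by linarith
      ultimately show ?thesis
        using all_odd True r hl m0 by (intro pos[of 0]) (auto simp: winning_budget_def)
    next
      case (zero_odd j)
      let ?c = "card {i. i < length p \<and> p ! i < m}"
      have "{i. i < length p \<and> odd (m - p ! i)} = {i. i < length p \<and> p ! i < m}"
        using zero_odd(4) by (auto dest: odd_pos simp del: even_diff_nat)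
      then have hc: "?h = ?c" by (simp add: odd_deficits_def)
      have b0: "budget p m 0" using b zero_odd by simp
      have sk: "skippable p j"
        using skippable_iff_zero_budget[OF b0 zero_odd(1,2)] hc h by simp
      note S = skip_zero_budget[OF b0 zero_odd(2) sk]
      have "odd_deficits (skip p j) (m - 2) = 0" using S(5) hc by simp
      moreover have "even (m - 2)" using True by simp
      ultimately have "winning_budget (length p) (m - 2) (?c - 2) (odd_deficits (skip p j) (m - 2))"
        by (simp add: winning_budget_def)
      then show ?thesis
        using sk S(1,4) by (intro exI[of _ j] exI[of _ "m - 2"] exI[of _ "?c - 2"]) auto
    qed
  qed
qed

text \<open>Induction on \<open>m\<close>, which every legal skip lowers; \<open>r\<close> must vary
  because a skip with \<open>r = 0\<close> resets it.\<close>

lemma P_position_iff_winning_budget: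
  assumes "budget p m r"
  shows "P_position {length p - 1} p \<longleftrightarrow> winning_budget (length p) m r (odd_deficits p m)"
  using assms
proof (induction m arbitrary: p r rule: less_induct)
  case (less m)
  have iff: "P_position {length p - 1} p \<longleftrightarrow>
      (\<forall>j. skippable p j \<longrightarrow> \<not> P_position {length p - 1} (skip p j))"
    using P_position_iff_skip budget_bound[OF less.prems] by simp
  have IH: "P_position {length p - 1} (skip p j) \<longleftrightarrow>
      winning_budget (length p) m' r' (odd_deficits (skip p j) m')"
    if "m' < m" "budget (skip p j) m' r'" for j m' r'
    using less.IH[OF that] by simp
  show ?case
    using iff IH winning_budget_skip[OF less.prems] not_winning_budget_skip[OF less.prems] by metis
qed

section \<open>Height bound and budget of reduced positions\<close>

lemma sum_list_skip:
  assumes "skippable p j"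
  shows "sum_list (skip p j) + (length p - 1) = sum_list p"
proof -
  have j: "j < length p" using assms by (simp add: skippable_def)
  have "sum_list p = p ! j + (\<Sum>i\<in>{0..<length p} - {j}. p ! i)"
    unfolding sum_list_sum_nth using j by (intro sum.remove) auto
  also have "(\<Sum>i\<in>{0..<length p} - {j}. p ! i) = (\<Sum>i\<in>{0..<length p} - {j}. skip p j ! i + 1)"
    using assms by (intro sum.cong) (auto simp: nth_skip skippable_def)
  also have "\<dots> = (\<Sum>i\<in>{0..<length p} - {j}. skip p j ! i) + (length p - 1)"
    using j by (subst sum.distrib) simp
  also have "p ! j + \<dots> = (skip p j ! j + (\<Sum>i\<in>{0..<length p} - {j}. skip p j ! i)) + (length p - 1)"
    using j by (simp add: nth_skip)
  also have "skip p j ! j + (\<Sum>i\<in>{0..<length p} - {j}. skip p j ! i) = sum_list (skip p j)"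
    unfolding sum_list_sum_nth length_skip using j by (intro sum.remove[symmetric]) auto
  finally show ?thesis by simp
qed

text \<open>Every move takes \<open>n - 1\<close> tokens in total and at most one from stack \<open>i\<close>.\<close>

lemma reachable_height_bound:
  assumes "(move {length p - 1})\<^sup>*\<^sup>* p t" and "i < length p"
  shows "(length p - 1) * (p ! i) + sum_list t \<le> (length p - 1) * (t ! i) + sum_list p"
  using assms(1)
proof (induction rule: rtranclp_induct)
  case (step y z)
  have len: "length y = length p" using reachable_length_le step.hyps(1) by blast
  then obtain j where j: "skippable y j" and z: "z = skip y j"
    using step.hyps(2) move_iff_skip[of y] assms(2) by auto
  have "y ! i \<le> z ! i + 1" using len assms(2) by (cases "i = j") (auto simp: z nth_skip)
  then have "(length p - 1) * (y ! i) \<le> (length p - 1) * (z ! i + 1)"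
    by (rule mult_le_mono2)
  moreover have "sum_list z + (length p - 1) = sum_list y"
    using sum_list_skip[OF j] z len by simp
  ultimately show ?case using step.IH by (simp add: algebra_simps)
qed simp

text \<open>Some play from a reduced position empties stack \<open>i\<close>; along it
  \<open>reachable_height_bound\<close> applies with final height 0.\<close>

lemma reduced_height_bound:
  assumes "length p \<ge> 2" "reduced {length p - 1} p" "i < length p"
  shows "(length p - 1) * (p ! i) \<le> sum_list p"
proof (cases "p ! i = 0")
  case False
  let ?A = "{length p - 1}"
  let ?T = "{t ! i |t. t \<in> reachable_terminals ?A p}"
  have "reduction ?A p ! i = p ! i"
    using assms(2) by (simp add: reduced_def)
  then have "p ! i - unused ?A p i = p ! i"
    using assms(3) by (simp add: reduction_def)
  \<comment> \<open>A truncated difference equal to a positive \<open>p ! i\<close> forces the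
    subtrahend to be 0; an empty stack is settled by the other case.\<close>
  then have "Min ?T = 0" using False by (simp add: unused_def)
  moreover have "Min ?T \<in> ?T"
  proof (rule Min_in)
    show "finite ?T" using finite_reachable_terminals[of ?A p] by simp
    show "?T \<noteq> {}" using reachable_terminals_nonempty[of ?A p] assms(1) by auto
  qed
  ultimately have "0 \<in> ?T" by (simp only:)
  then obtain t where "(move ?A)\<^sup>*\<^sup>* p t" "t ! i = 0"
    by (auto simp: reachable_terminals_def)
  then show ?thesis using reachable_height_bound[OF _ assms(3), of t] by simp
qed simp

text \<open>Since no height exceeds \<open>m\<close>, the deficits sum to
  \<open>length p * m - sum_list p\<close>, which is \<open>m\<close> minus the remainder. All
  stacks then count in the maximality condition, so a remainder below \<open>length p - 1\<close>
  suffices.\<close>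

lemma reduced_budget:
  assumes "length p \<ge> 2" "reduced {length p - 1} p"
  defines "m \<equiv> sum_list p div (length p - 1)"
  shows "\<forall>i<length p. p ! i \<le> m" and "budget p m (sum_list p mod (length p - 1))"
proof -
  let ?k = "length p - 1"
  show le: "\<forall>i<length p. p ! i \<le> m"
    using reduced_height_bound[OF assms(1,2)] assms(1)
    by (auto simp: m_def less_eq_div_iff_mult_less_eq mult.commute)
  have "(\<Sum>i<length p. m - p ! i) = (\<Sum>i<length p. m) - (\<Sum>i<length p. p ! i)"
    by (rule sum_subtractf_nat) (use le in auto)
  moreover have "(\<Sum>i<length p. p ! i) = sum_list p"
    by (simp add: sum_list_sum_nth lessThan_atLeast0)
  moreover have "(\<Sum>i<length p. m) = ?k * m + m"
    using assms(1) by (cases "length p") auto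
  moreover have "?k * m + sum_list p mod ?k = sum_list p" by (simp add: m_def)
  moreover have "sum_list p \<le> (\<Sum>i<length p. m)"
    unfolding \<open>(\<Sum>i<length p. p ! i) = sum_list p\<close>[symmetric] by (rule sum_mono) (use le in auto)
  ultimately have "(\<Sum>i<length p. m - p ! i) + sum_list p mod ?k = m" by linarith
  moreover have "{i. i < length p \<and> p ! i \<le> m} = {..<length p}" using le by auto
  moreover have "sum_list p mod ?k < ?k" using assms(1) by simp
  ultimately show "budget p m (sum_list p mod ?k)" by (simp add: budget_def)
qed

section \<open>Translation to the pairs of residue and number of odd stacks\<close>

text \<open>A height and its deficit have equal parity exactly when \<open>m\<close> is
  even.\<close>

lemma num_odd_deficits:
  assumes "\<forall>i<length p. p ! i \<le> m"
  shows "num_odd p = (if even m then odd_deficits p m else length p - odd_deficits p m)"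
proof -
  let ?O = "{i. i < length p \<and> odd (m - p ! i)}"
  have "{i. i < length p \<and> odd (p ! i)} = (if even m then ?O else {..<length p} - ?O)"
    using assms by auto
  moreover have "card ({..<length p} - ?O) = length p - card ?O"
    by (subst card_Diff_subset) auto
  ultimately show ?thesis by (simp add: num_odd_def odd_deficits_def del: even_diff_nat)
qed

lemma even_sum_list_iff_num_odd: "even (sum_list p) \<longleftrightarrow> even (num_odd p)"
  using even_sum_iff_even_card_odd[of "{0..<length p}" "\<lambda>i. p ! i"]
  by (simp add: sum_list_sum_nth num_odd_def)

theorem theorem4:
  fixes n k :: nat
  assumes "n \<ge> 2" and "k = n - 1"
  shows "(\<forall>p \<in> positions n. even (sum_list p mod (2 * k)) \<longleftrightarrow> even (num_odd p)) \<and>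
    (\<forall>p \<in> positions n. reduced {k} p \<longrightarrow>
       (P_position {k} p \<longleftrightarrow> (sum_list p mod (2 * k), num_odd p) \<in> S1 k \<union> S2 n \<union> S3 k))"
proof (intro conjI ballI impI)
  fix p
  show "even (sum_list p mod (2 * k)) \<longleftrightarrow> even (num_odd p)"
    using even_sum_list_iff_num_odd dvd_mod_iff[of 2 "2 * k" "sum_list p"] by simp
next
  fix p
  assume "p \<in> positions n" and red: "reduced {k} p"
  then have len: "length p = n" by (simp add: positions_def)
  define s where "s = sum_list p mod (2 * k)"
  define m where "m = sum_list p div k"
  define r where "r = sum_list p mod k"
  define h where "h = odd_deficits p m"
  have k: "k = length p - 1" "n = k + 1" using assms len by auto
  have le: "\<forall>i<length p. p ! i \<le> m" and b: "budget p m r"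
    using reduced_budget[of p] red assms(1) unfolding m_def r_def k(1) len by blast+
  have P: "P_position {k} p \<longleftrightarrow> winning_budget n m r h"
    using P_position_iff_winning_budget[OF b] unfolding h_def k(1) len .
  \<comment> \<open>Modulo \<open>2 * k\<close> only the parity of the quotient \<open>m\<close>
    survives, next to the remainder \<open>r\<close>.\<close>
  have s: "s = (if even m then r else k + r)"
    using mod_mult2_eq[of "sum_list p" k 2]
    by (simp add: s_def m_def r_def mod2_eq_if mult.commute)
  have o: "num_odd p = (if even m then h else n - h)"
    using num_odd_deficits[OF le] by (simp add: h_def len)
  have "r < k" using assms by (simp add: r_def)
  have "h \<le> n" using odd_deficits_le[of p m] by (simp add: h_def len)
  have par: "s mod 2 = num_odd p mod 2"
    using even_sum_list_iff_num_odd[of p] dvd_mod_iff[of 2 "2 * k" "sum_list p"]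
    by (simp add: s_def mod2_eq_if)
  have "winning_budget n m r h \<longleftrightarrow> (s, num_odd p) \<in> S1 k \<union> S2 n \<union> S3 k"
  proof (cases "even m")
    case True
    \<comment> \<open>Here \<open>s = r < k\<close> rules out \<open>S3\<close>; \<open>S2\<close>
      is the extreme value \<open>r = n - 2\<close>.\<close>
    have "(r, h) \<in> S1 k \<union> S2 n \<union> S3 k \<longleftrightarrow> r < k - 1 \<and> h \<le> r \<or> r + 2 = n"
      using par s o True \<open>r < k\<close> k(2) by (auto simp: S1_def S2_def S3_def)
    then show ?thesis
      using True s o \<open>r < k\<close> k(2) by (auto simp: winning_budget_def)
  next
    case False
    \<comment> \<open>Here \<open>s \<ge> k\<close> exceeds every residue in \<open>S1\<close> and
      \<open>S2\<close>, so only \<open>S3\<close> remains.\<close>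
    have "(k + r, n - h) \<in> S1 k \<union> S2 n \<union> S3 k \<longleftrightarrow> k + r < 2 * k - 1 \<and> n - h \<le> 2 * (k - 1) - (k + r)"
      using par s o False \<open>r < k\<close> k(2) by (auto simp: S1_def S2_def S3_def)
    \<comment> \<open>With \<open>n = k + 1\<close> the second bound reads
      \<open>k + 1 - h \<le> k - 2 - r\<close>; the first one prevents truncation and in turn
      follows from \<open>r + 3 \<le> h \<le> n\<close>.\<close>
    also have "\<dots> \<longleftrightarrow> r + 3 \<le> h"
      using \<open>h \<le> n\<close> \<open>r < k\<close> k(2) by auto
    finally show ?thesis
      using False s o by (simp add: winning_budget_def)
  qed
  then show "P_position {k} p \<longleftrightarrow> (sum_list p mod (2 * k), num_odd p) \<in> S1 k \<union> S2 n \<union> S3 k"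
    using P by (simp add: s_def)
qed

end
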